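(* Let $G=(V,E)$ be a non-oriented, countable, locally finite, connected graph. Then the operator $\Delta_m : C_c(V)\to \ell^2(V)$, $f\mapsto \Delta f$, regarded as a densely defined operator on the Hilbert space $\ell^2(V)$ with domain $C_c(V)$, is essentially self-adjoint.
   Context: For $x,y\in V$, $x\sim y$ means that $x$ and $y$ are joined by an edge; $m(x)=\#\{y\in V: y\sim x\}<\infty$ is the valence of $x$ (the valence may be unbounded on $V$). $\ell^2(V)=\{f:V\to\mathbb{C} : \sum_{x\in V}|f(x)|^2<\infty\}$ is the complex Hilbert space with inner product $\langle f,g\rangle=\sum_{x\in V} f(x)\overline{g(x)}$. $C_c(V)\subset\ell^2(V)$ is the dense subspace of functions $f:V\to\mathbb{C}$ with finite support. The (physical) Laplacian is defined for any function $f$ on $V$ by $\Delta f(x)=m(x)f(x)-\sum_{y\sim x}f(y)=\sum_{y\sim x}(f(x)-f(y))$. *)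

theory Defs
  imports "HOL-Analysis.Analysis"
begin

section \<open>Non-oriented graphs\<close>

text \<open>
  An edge is the unordered pair of its end points, so a loop is a singleton. Loops are allowed:
  they cancel in the Laplacian. Parallel edges are irrelevant, since everything below depends only
  on the adjacency relation.
\<close>

definition ugraph :: "'v set \<Rightarrow> 'v set set \<Rightarrow> bool" where
  "ugraph V E \<longleftrightarrow> (\<forall>e\<in>E. \<exists>x\<in>V. \<exists>y\<in>V. e = {x, y})"

definition adj :: "'v set set \<Rightarrow> 'v \<Rightarrow> 'v \<Rightarrow> bool" where
  "adj E x y \<longleftrightarrow> {x, y} \<in> E"

definition nbrs :: "'v set \<Rightarrow> 'v set set \<Rightarrow> 'v \<Rightarrow> 'v set" where
  "nbrs V E x = {y \<in> V. adj E y x}"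

definition valence :: "'v set \<Rightarrow> 'v set set \<Rightarrow> 'v \<Rightarrow> nat" where
  "valence V E x = card (nbrs V E x)"

definition locally_finite_graph :: "'v set \<Rightarrow> 'v set set \<Rightarrow> bool" where
  "locally_finite_graph V E \<longleftrightarrow> (\<forall>x\<in>V. finite (nbrs V E x))"

definition connected_graph :: "'v set \<Rightarrow> 'v set set \<Rightarrow> bool" where
  "connected_graph V E \<longleftrightarrow> (\<forall>x\<in>V. \<forall>y\<in>V. (adj E)\<^sup>*\<^sup>* x y)"

section \<open>The Hilbert space of square-summable functions\<close>

text \<open>
  A function from \<open>V\<close> to the complex numbers is represented by its extension by zero to the
  whole vertex type, so that equality of representatives is equality on \<open>V\<close>.
\<close>

definition funs_on :: "'v set \<Rightarrow> ('v \<Rightarrow> complex) set" where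
  "funs_on V = {f. \<forall>x. x \<notin> V \<longrightarrow> f x = 0}"

definition l2 :: "'v set \<Rightarrow> ('v \<Rightarrow> complex) set" where
  "l2 V = {f \<in> funs_on V. (\<lambda>x. (cmod (f x))\<^sup>2) summable_on V}"

definition l2_inner :: "'v set \<Rightarrow> ('v \<Rightarrow> complex) \<Rightarrow> ('v \<Rightarrow> complex) \<Rightarrow> complex" where
  "l2_inner V f g = (\<Sum>\<^sub>\<infinity>x\<in>V. f x * cnj (g x))"

definition l2_norm :: "'v set \<Rightarrow> ('v \<Rightarrow> complex) \<Rightarrow> real" where
  "l2_norm V f = sqrt (\<Sum>\<^sub>\<infinity>x\<in>V. (cmod (f x))\<^sup>2)"

definition l2_dist :: "'v set \<Rightarrow> ('v \<Rightarrow> complex) \<Rightarrow> ('v \<Rightarrow> complex) \<Rightarrow> real" where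
  "l2_dist V f g = l2_norm V (\<lambda>x. f x - g x)"

definition l2_dense :: "'v set \<Rightarrow> ('v \<Rightarrow> complex) set \<Rightarrow> bool" where
  "l2_dense V D \<longleftrightarrow> D \<subseteq> l2 V \<and> (\<forall>f\<in>l2 V. \<forall>\<epsilon>>0. \<exists>g\<in>D. l2_dist V f g < \<epsilon>)"

definition finsupp_funs :: "'v set \<Rightarrow> ('v \<Rightarrow> complex) set" where
  "finsupp_funs V = {f \<in> funs_on V. finite {x \<in> V. f x \<noteq> 0}}"

section \<open>Unbounded operators\<close>

text \<open>An unbounded operator is identified with its graph; its domain is the \<open>Domain\<close> of the graph.\<close>

type_synonym 'v op_graph = "(('v \<Rightarrow> complex) \<times> ('v \<Rightarrow> complex)) set"

definition linear_op :: "'v set \<Rightarrow> 'v op_graph \<Rightarrow> bool" where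
  "linear_op V T \<longleftrightarrow>
     T \<subseteq> l2 V \<times> l2 V \<and> single_valued T \<and> ((\<lambda>x. 0), (\<lambda>x. 0)) \<in> T \<and>
     (\<forall>f f' g g'. (f, f') \<in> T \<longrightarrow> (g, g') \<in> T \<longrightarrow>
        ((\<lambda>x. f x + g x), (\<lambda>x. f' x + g' x)) \<in> T) \<and>
     (\<forall>c f f'. (f, f') \<in> T \<longrightarrow> ((\<lambda>x. c * f x), (\<lambda>x. c * f' x)) \<in> T)"

definition densely_defined_op :: "'v set \<Rightarrow> 'v op_graph \<Rightarrow> bool" where
  "densely_defined_op V T \<longleftrightarrow> linear_op V T \<and> l2_dense V (Domain T)"

definition symmetric_op :: "'v set \<Rightarrow> 'v op_graph \<Rightarrow> bool" where
  "symmetric_op V T \<longleftrightarrow> densely_defined_op V T \<and>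
     (\<forall>f f' g g'. (f, f') \<in> T \<longrightarrow> (g, g') \<in> T \<longrightarrow> l2_inner V f' g = l2_inner V f g')"

definition op_adjoint :: "'v set \<Rightarrow> 'v op_graph \<Rightarrow> 'v op_graph" where
  "op_adjoint V T = {(g, h) \<in> l2 V \<times> l2 V.
     \<forall>f f'. (f, f') \<in> T \<longrightarrow> l2_inner V f' g = l2_inner V f h}"

definition op_closure :: "'v set \<Rightarrow> 'v op_graph \<Rightarrow> 'v op_graph" where
  "op_closure V T = {(f, g) \<in> l2 V \<times> l2 V.
     \<exists>u v. (\<forall>n::nat. (u n, v n) \<in> T) \<and>
       (\<lambda>n. l2_dist V (u n) f) \<longlonglongrightarrow> 0 \<and> (\<lambda>n. l2_dist V (v n) g) \<longlonglongrightarrow> 0}"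

definition self_adjoint_op :: "'v set \<Rightarrow> 'v op_graph \<Rightarrow> bool" where
  "self_adjoint_op V T \<longleftrightarrow> densely_defined_op V T \<and> op_adjoint V T = T"

definition essentially_self_adjoint :: "'v set \<Rightarrow> 'v op_graph \<Rightarrow> bool" where
  "essentially_self_adjoint V T \<longleftrightarrow> symmetric_op V T \<and> self_adjoint_op V (op_closure V T)"

section \<open>The physical Laplacian\<close>

definition laplacian :: "'v set \<Rightarrow> 'v set set \<Rightarrow> ('v \<Rightarrow> complex) \<Rightarrow> 'v \<Rightarrow> complex" where
  "laplacian V E f x =
     (if x \<in> V then of_nat (valence V E x) * f x - (\<Sum>y\<in>nbrs V E x. f y) else 0)"

lemma laplacian_eq_sum_diff:
  "x \<in> V \<Longrightarrow> laplacian V E f x = (\<Sum>y\<in>nbrs V E x. f x - f y)"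
  by (simp add: laplacian_def valence_def sum_subtractf)

definition laplacian_min :: "'v set \<Rightarrow> 'v set set \<Rightarrow> 'v op_graph" where
  "laplacian_min V E = {(f, laplacian V E f) | f. f \<in> finsupp_funs V}"

end

theory Submission
  imports Defs
begin

text \<open>
  Write \<open>A\<close> for the Laplacian \<open>\<Delta>\<close> restricted to the finitely supported functions. Green's formula
  for one finitely supported factor identifies the adjoint of \<open>A\<close> with the maximal operator, which
  is \<open>\<Delta>\<close> on all \<open>g\<close> such that \<open>g\<close> and \<open>\<Delta> g\<close> are square-summable. The theorem therefore says that
  the closure of \<open>A\<close> is already the maximal operator, and this rests on two facts.

  First, \<open>\<Delta> g = - g\<close> has no nonzero square-summable solution. A square-summable \<open>g \<noteq> 0\<close>
  attains the maximum of its modulus at some vertex \<open>b\<close>, because its superlevel sets are finite.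
  There \<open>(m b + 1) g b\<close> equals the sum of \<open>g\<close> over the \<open>m b\<close> neighbours of \<open>b\<close>, whose modulus is at
  most \<open>m b * \<bar>g b\<bar>\<close>; hence \<open>g b = 0\<close> (\<open>laplacian_eigenvalue_minus_one\<close>).

  Second, \<open>A\<close> is nonnegative, so \<open>\<parallel>u\<parallel> \<le> \<parallel>A u + u\<parallel>\<close> (\<open>l2_norm_le_laplacian_plus_id\<close>).

  By the first fact the orthogonal complement of the range of \<open>A + 1\<close> is trivial, so that range is
  dense (\<open>l2_dense_range_laplacian_plus_id\<close>). Given \<open>g\<close> in the maximal domain, choose finitely
  supported \<open>u n\<close> with \<open>A (u n) + u n\<close> converging to \<open>\<Delta> g + g\<close>. By the second fact \<open>u n\<close> is
  Cauchy. Its limit \<open>f\<close> lies in the domain of the closure and satisfies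
  \<open>\<Delta> f + f = \<Delta> g + g\<close>, and the first fact, applied to \<open>g - f\<close>, gives \<open>g = f\<close>
  (\<open>laplacian_max_subset_op_closure\<close>).

  The Hilbert space enters through completeness and through the criterion that a subspace with
  trivial orthogonal complement is dense; both are proved below for \<open>l2 V\<close>.
\<close>

section \<open>Square-summable functions form a Hilbert space\<close>

lemma l2_funs_on: "f \<in> l2 V \<Longrightarrow> x \<notin> V \<Longrightarrow> f x = 0"
  by (simp add: l2_def funs_on_def)

lemma l2_summable: "f \<in> l2 V \<Longrightarrow> (\<lambda>x. (cmod (f x))\<^sup>2) summable_on V"
  by (simp add: l2_def)

lemma l2_add:
  assumes "f \<in> l2 V" "g \<in> l2 V"
  shows "(\<lambda>x. f x + g x) \<in> l2 V"
proof -
  have "(\<lambda>x. 2 * (cmod (f x))\<^sup>2 + 2 * (cmod (g x))\<^sup>2) summable_on V"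
    by (intro summable_on_add summable_on_cmult_right l2_summable assms)
  moreover have "(cmod (f x + g x))\<^sup>2 \<le> 2 * (cmod (f x))\<^sup>2 + 2 * (cmod (g x))\<^sup>2" for x
  proof -
    have "(cmod (f x + g x))\<^sup>2 \<le> (cmod (f x) + cmod (g x))\<^sup>2"
      by (intro power_mono norm_triangle_ineq) auto
    also have "\<dots> \<le> 2 * (cmod (f x))\<^sup>2 + 2 * (cmod (g x))\<^sup>2"
      using sum_squares_bound[of "cmod (f x)" "cmod (g x)"] by (simp add: power2_sum)
    finally show ?thesis .
  qed
  ultimately have "(\<lambda>x. (cmod (f x + g x))\<^sup>2) summable_on V"
    by (rule summable_on_comparison_test) auto
  then show ?thesis
    using assms by (auto simp: l2_def funs_on_def)
qed

lemma l2_cmult: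
  assumes "f \<in> l2 V"
  shows "(\<lambda>x. c * f x) \<in> l2 V"
  using assms by (auto simp: l2_def funs_on_def norm_mult power_mult_distrib
      intro: summable_on_cmult_right)

lemma l2_diff:
  assumes "f \<in> l2 V" "g \<in> l2 V"
  shows "(\<lambda>x. f x - g x) \<in> l2 V"
  using l2_add[OF assms(1) l2_cmult[OF assms(2), of "-1"]] by simp

lemma finsupp_funs_subset_l2: "finsupp_funs V \<subseteq> l2 V"
proof
  fix f assume f: "f \<in> finsupp_funs V"
  then have "(\<lambda>x. (cmod (f x))\<^sup>2) summable_on {x \<in> V. f x \<noteq> 0}"
    by (simp add: finsupp_funs_def)
  then have "(\<lambda>x. (cmod (f x))\<^sup>2) summable_on V"
    by (rule summable_on_cong_neutral[THEN iffD1, rotated -1]) auto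
  with f show "f \<in> l2 V"
    by (simp add: l2_def finsupp_funs_def)
qed

lemma zero_in_finsupp_funs: "(\<lambda>x. 0) \<in> finsupp_funs V"
  by (simp add: finsupp_funs_def funs_on_def)

lemma finsupp_funs_add:
  assumes "f \<in> finsupp_funs V" "g \<in> finsupp_funs V"
  shows "(\<lambda>x. f x + g x) \<in> finsupp_funs V"
proof -
  have "finite {x \<in> V. f x + g x \<noteq> 0}"
    by (rule finite_subset[of _ "{x \<in> V. f x \<noteq> 0} \<union> {x \<in> V. g x \<noteq> 0}"])
      (use assms in \<open>auto simp: finsupp_funs_def\<close>)
  with assms show ?thesis
    by (simp add: finsupp_funs_def funs_on_def)
qed

lemma finsupp_funs_cmult: "f \<in> finsupp_funs V \<Longrightarrow> (\<lambda>x. c * f x) \<in> finsupp_funs V"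
  by (auto simp: finsupp_funs_def funs_on_def elim: rev_finite_subset)

lemma l2_zero: "(\<lambda>x. 0) \<in> l2 V"
  by (simp add: l2_def funs_on_def)

lemma abs_summable_l2_inner:
  assumes "f \<in> l2 V" "g \<in> l2 V"
  shows "(\<lambda>x. norm (f x * cnj (g x))) summable_on V"
proof (rule summable_on_comparison_test)
  show "(\<lambda>x. (cmod (f x))\<^sup>2 + (cmod (g x))\<^sup>2) summable_on V"
    by (intro summable_on_add l2_summable assms)
  show "norm (f x * cnj (g x)) \<le> (cmod (f x))\<^sup>2 + (cmod (g x))\<^sup>2" for x
  proof -
    have "0 \<le> cmod (f x) * cmod (g x)"
      by simp
    with sum_squares_bound[of "cmod (f x)" "cmod (g x)"] show ?thesis
      unfolding norm_mult complex_mod_cnj by linarith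
  qed
qed auto

lemma summable_l2_inner:
  "f \<in> l2 V \<Longrightarrow> g \<in> l2 V \<Longrightarrow> (\<lambda>x. f x * cnj (g x)) summable_on V"
  by (rule abs_summable_summable[OF abs_summable_l2_inner])

lemma l2_inner_add_left:
  assumes "f \<in> l2 V" "g \<in> l2 V" "h \<in> l2 V"
  shows "l2_inner V (\<lambda>x. f x + g x) h = l2_inner V f h + l2_inner V g h"
  unfolding l2_inner_def distrib_right
  by (intro infsum_add summable_l2_inner assms)

lemma l2_inner_cmult_left: "l2_inner V (\<lambda>x. c * f x) h = c * l2_inner V f h"
  by (simp add: l2_inner_def mult.assoc infsum_cmult_right')

lemma l2_inner_commute: "l2_inner V g f = cnj (l2_inner V f g)"
  by (simp add: l2_inner_def infsum_cnj[symmetric] mult.commute)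

lemma l2_inner_diff_left:
  assumes "f \<in> l2 V" "g \<in> l2 V" "h \<in> l2 V"
  shows "l2_inner V (\<lambda>x. f x - g x) h = l2_inner V f h - l2_inner V g h"
  using l2_inner_add_left[OF assms(1) l2_cmult[OF assms(2), of "-1"] assms(3)]
    l2_inner_cmult_left[of V "-1" g h] by simp

lemma l2_inner_add_right:
  assumes "f \<in> l2 V" "g \<in> l2 V" "h \<in> l2 V"
  shows "l2_inner V h (\<lambda>x. f x + g x) = l2_inner V h f + l2_inner V h g"
  by (metis l2_inner_commute l2_inner_add_left[OF assms] complex_cnj_add)

lemma l2_inner_diff_right:
  assumes "f \<in> l2 V" "g \<in> l2 V" "h \<in> l2 V"
  shows "l2_inner V h (\<lambda>x. f x - g x) = l2_inner V h f - l2_inner V h g"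
  by (metis l2_inner_commute l2_inner_diff_left[OF assms] complex_cnj_diff)

lemma l2_norm_nonneg: "0 \<le> l2_norm V f"
  by (simp add: l2_norm_def infsum_nonneg)

lemma l2_norm_power2: "(l2_norm V f)\<^sup>2 = (\<Sum>\<^sub>\<infinity>x\<in>V. (cmod (f x))\<^sup>2)"
  by (simp add: l2_norm_def infsum_nonneg)

lemma l2_inner_self:
  assumes "f \<in> l2 V"
  shows "l2_inner V f f = complex_of_real ((l2_norm V f)\<^sup>2)"
  unfolding l2_norm_power2 l2_inner_def complex_norm_square[symmetric]
  using has_sum_of_real[OF has_sum_infsum[OF l2_summable[OF assms]]] by (rule infsumI)

lemma l2_norm_cmult: "l2_norm V (\<lambda>x. c * f x) = cmod c * l2_norm V f"
  by (simp add: l2_norm_def norm_mult power_mult_distrib infsum_cmult_right' real_sqrt_mult)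

lemma L2_set_le_l2_norm:
  assumes "f \<in> l2 V" "finite F" "F \<subseteq> V"
  shows "L2_set (\<lambda>x. cmod (f x)) F \<le> l2_norm V f"
  unfolding L2_set_def l2_norm_def
  using assms by (intro real_sqrt_le_mono finite_sum_le_infsum l2_summable) auto

lemma cmod_le_l2_norm:
  assumes "f \<in> l2 V"
  shows "cmod (f x) \<le> l2_norm V f"
proof (cases "x \<in> V")
  case True
  then show ?thesis
    using L2_set_le_l2_norm[OF assms, of "{x}"] by (simp add: L2_set_def)
qed (use assms in \<open>simp add: l2_funs_on l2_norm_nonneg\<close>)

lemma l2_Cauchy_Schwarz:
  assumes "f \<in> l2 V" "g \<in> l2 V"
  shows "cmod (l2_inner V f g) \<le> l2_norm V f * l2_norm V g"
proof -
  have "cmod (l2_inner V f g) \<le> (\<Sum>\<^sub>\<infinity>x\<in>V. cmod (f x * cnj (g x)))"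
    unfolding l2_inner_def by (rule norm_infsum_bound[OF abs_summable_l2_inner[OF assms]])
  also have "\<dots> \<le> l2_norm V f * l2_norm V g"
  proof (rule infsum_le_finite_sums[OF abs_summable_l2_inner[OF assms]])
    fix F assume F: "finite F" "F \<subseteq> V"
    have "(\<Sum>x\<in>F. cmod (f x * cnj (g x))) = (\<Sum>x\<in>F. \<bar>cmod (f x)\<bar> * \<bar>cmod (g x)\<bar>)"
      by (simp add: norm_mult)
    also have "\<dots> \<le> L2_set (\<lambda>x. cmod (f x)) F * L2_set (\<lambda>x. cmod (g x)) F"
      by (rule L2_set_mult_ineq)
    also have "\<dots> \<le> l2_norm V f * l2_norm V g"
      using F assms by (intro mult_mono L2_set_le_l2_norm l2_norm_nonneg) auto
    finally show "(\<Sum>x\<in>F. cmod (f x * cnj (g x))) \<le> l2_norm V f * l2_norm V g" .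
  qed
  finally show ?thesis .
qed

lemma l2_norm_add_power2:
  assumes "f \<in> l2 V" "g \<in> l2 V"
  shows "(l2_norm V (\<lambda>x. f x + g x))\<^sup>2
    = (l2_norm V f)\<^sup>2 + (l2_norm V g)\<^sup>2 + 2 * Re (l2_inner V f g)"
proof -
  have "complex_of_real ((l2_norm V (\<lambda>x. f x + g x))\<^sup>2)
    = l2_inner V f f + l2_inner V g g + (l2_inner V f g + l2_inner V g f)"
    using assms by (simp add: l2_inner_self[symmetric] l2_inner_add_left l2_inner_add_right l2_add
        del: of_real_power)
  then have "Re (complex_of_real ((l2_norm V (\<lambda>x. f x + g x))\<^sup>2))
    = Re (l2_inner V f f) + Re (l2_inner V g g) + 2 * Re (l2_inner V f g)"
    using l2_inner_commute[of V g f] by simp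
  then show ?thesis
    using assms by (simp add: l2_inner_self del: of_real_power)
qed

lemma l2_norm_diff_power2:
  assumes "f \<in> l2 V" "g \<in> l2 V"
  shows "(l2_norm V (\<lambda>x. f x - g x))\<^sup>2
    = (l2_norm V f)\<^sup>2 + (l2_norm V g)\<^sup>2 - 2 * Re (l2_inner V f g)"
  using l2_norm_add_power2[OF assms(1) l2_cmult[OF assms(2), of "-1"]]
    l2_norm_cmult[of V "-1" g] l2_inner_commute[of V f "\<lambda>x. - 1 * g x"]
    l2_inner_cmult_left[of V "-1" g f] l2_inner_commute[of V f g]
  by simp

lemma l2_norm_triangle:
  assumes "f \<in> l2 V" "g \<in> l2 V"
  shows "l2_norm V (\<lambda>x. f x + g x) \<le> l2_norm V f + l2_norm V g"
proof (rule power2_le_imp_le)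
  have "Re (l2_inner V f g) \<le> l2_norm V f * l2_norm V g"
    using l2_Cauchy_Schwarz[OF assms] complex_Re_le_cmod order_trans by blast
  then show "(l2_norm V (\<lambda>x. f x + g x))\<^sup>2 \<le> (l2_norm V f + l2_norm V g)\<^sup>2"
    by (simp add: l2_norm_add_power2[OF assms] power2_sum)
qed (simp add: l2_norm_nonneg)

lemma l2_dist_commute: "l2_dist V f g = l2_dist V g f"
  by (simp add: l2_dist_def l2_norm_def norm_minus_commute)

lemma l2_dist_triangle:
  assumes "f \<in> l2 V" "g \<in> l2 V" "h \<in> l2 V"
  shows "l2_dist V f h \<le> l2_dist V f g + l2_dist V g h"
  using l2_norm_triangle[OF l2_diff[OF assms(1,2)] l2_diff[OF assms(2,3)]]
  by (simp add: l2_dist_def)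

lemma l2_tendsto_pointwise:
  assumes "\<And>n. u n \<in> l2 V" "f \<in> l2 V" "(\<lambda>n. l2_dist V (u n) f) \<longlonglongrightarrow> 0"
  shows "(\<lambda>n. u n x) \<longlonglongrightarrow> f x"
proof (rule LIM_zero_cancel, rule Lim_null_comparison)
  show "\<forall>\<^sub>F n in sequentially. norm (u n x - f x) \<le> l2_dist V (u n) f"
    using cmod_le_l2_norm[OF l2_diff[OF assms(1,2)]] by (simp add: l2_dist_def)
qed (fact assms(3))

lemma tendsto_l2_inner_left:
  assumes "\<And>n. u n \<in> l2 V" "f \<in> l2 V" "g \<in> l2 V" "(\<lambda>n. l2_dist V (u n) f) \<longlonglongrightarrow> 0"
  shows "(\<lambda>n. l2_inner V (u n) g) \<longlonglongrightarrow> l2_inner V f g"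
proof (rule LIM_zero_cancel, rule Lim_null_comparison)
  show "\<forall>\<^sub>F n in sequentially.
      norm (l2_inner V (u n) g - l2_inner V f g) \<le> l2_dist V (u n) f * l2_norm V g"
    using l2_Cauchy_Schwarz[OF l2_diff[OF assms(1,2)] assms(3)] assms
    by (simp add: l2_dist_def l2_inner_diff_left)
  show "(\<lambda>n. l2_dist V (u n) f * l2_norm V g) \<longlonglongrightarrow> 0"
    using tendsto_mult_left_zero[OF assms(4)] .
qed

lemma l2_bounded_finite_sums:
  assumes "f \<in> funs_on V" "0 \<le> c"
    and "\<And>F. finite F \<Longrightarrow> F \<subseteq> V \<Longrightarrow> (\<Sum>x\<in>F. (cmod (f x))\<^sup>2) \<le> c\<^sup>2"
  shows "f \<in> l2 V" "l2_norm V f \<le> c"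
proof -
  have s: "(\<lambda>x. (cmod (f x))\<^sup>2) summable_on V"
    by (rule nonneg_bdd_above_summable_on) (auto intro!: bdd_aboveI2[where M="c\<^sup>2"] assms(3))
  then show "f \<in> l2 V"
    using assms(1) by (simp add: l2_def)
  have "(l2_norm V f)\<^sup>2 \<le> c\<^sup>2"
    unfolding l2_norm_power2 by (intro infsum_le_finite_sums s assms(3))
  then show "l2_norm V f \<le> c"
    using assms(2) by (rule power2_le_imp_le)
qed

text \<open>
  The limit is taken pointwise. The Cauchy estimate bounds all finite partial sums of
  \<open>\<bar>u n - u m\<bar>\<^sup>2\<close> uniformly, and letting \<open>m\<close> tend to infinity in each finite sum bounds those of
  \<open>\<bar>u n - f\<bar>\<^sup>2\<close>.
\<close>

lemma l2_complete:
  assumes u: "\<And>n. u n \<in> l2 V"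
    and cauchy: "\<And>e. 0 < e \<Longrightarrow> \<exists>N. \<forall>m\<ge>N. \<forall>n\<ge>N. l2_dist V (u m) (u n) < e"
  obtains f where "f \<in> l2 V" "(\<lambda>n. l2_dist V (u n) f) \<longlonglongrightarrow> 0"
proof -
  define f where "f x = lim (\<lambda>n. u n x)" for x
  have f: "(\<lambda>n. u n x) \<longlonglongrightarrow> f x" for x
  proof -
    have "cmod (u m x - u n x) \<le> l2_dist V (u m) (u n)" for m n
      using cmod_le_l2_norm[OF l2_diff[OF u u]] by (simp add: l2_dist_def)
    then have "Cauchy (\<lambda>n. u n x)"
      unfolding Cauchy_def dist_norm by (meson cauchy le_less_trans)
    then show ?thesis
      unfolding f_def by (simp add: Cauchy_convergent_iff convergent_LIMSEQ_iff)
  qed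
  have f_out: "f x = 0" if "x \<notin> V" for x
    using f[of x] by (simp add: l2_funs_on[OF u that] LIMSEQ_const_iff)
  have tail: "\<exists>N. \<forall>n\<ge>N. (\<lambda>x. u n x - f x) \<in> l2 V \<and> l2_dist V (u n) f \<le> e" if "0 < e" for e
  proof -
    obtain N where N: "\<And>m n. N \<le> m \<Longrightarrow> N \<le> n \<Longrightarrow> l2_dist V (u m) (u n) < e"
      using cauchy[OF \<open>0 < e\<close>] by blast
    have "(\<Sum>x\<in>F. (cmod (u n x - f x))\<^sup>2) \<le> e\<^sup>2" if n: "N \<le> n" and F: "finite F" "F \<subseteq> V" for n F
    proof (rule LIMSEQ_le_const2)
      show "(\<lambda>m. \<Sum>x\<in>F. (cmod (u n x - u m x))\<^sup>2) \<longlonglongrightarrow> (\<Sum>x\<in>F. (cmod (u n x - f x))\<^sup>2)"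
        by (intro tendsto_intros f)
      have "(\<Sum>x\<in>F. (cmod (u n x - u m x))\<^sup>2) \<le> e\<^sup>2" if "N \<le> m" for m
      proof -
        have "(\<Sum>x\<in>F. (cmod (u n x - u m x))\<^sup>2) \<le> (l2_dist V (u n) (u m))\<^sup>2"
          unfolding l2_dist_def l2_norm_power2
          using F by (intro finite_sum_le_infsum l2_summable l2_diff u) auto
        also have "\<dots> \<le> e\<^sup>2"
          using N[OF n that] by (intro power_mono) (auto simp: l2_dist_def l2_norm_nonneg)
        finally show ?thesis .
      qed
      then show "\<exists>M. \<forall>m\<ge>M. (\<Sum>x\<in>F. (cmod (u n x - u m x))\<^sup>2) \<le> e\<^sup>2"
        by blast
    qed
    then have "(\<lambda>x. u n x - f x) \<in> l2 V \<and> l2_dist V (u n) f \<le> e" if "N \<le> n" for n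
      using l2_bounded_finite_sums[of "\<lambda>x. u n x - f x" V e] \<open>0 < e\<close> that f_out l2_funs_on[OF u]
      by (auto simp: l2_dist_def funs_on_def)
    then show ?thesis by blast
  qed
  show thesis
  proof
    obtain N where "(\<lambda>x. u N x - f x) \<in> l2 V"
      using tail[of 1] by auto
    then show "f \<in> l2 V"
      using l2_diff[OF u[of N], of "\<lambda>x. u N x - f x"] by simp
    show "(\<lambda>n. l2_dist V (u n) f) \<longlonglongrightarrow> 0"
    proof (rule LIMSEQ_I)
      fix e :: real assume "0 < e"
      then obtain N where "\<forall>n\<ge>N. l2_dist V (u n) f \<le> e / 2"
        using tail[of "e / 2"] by auto
      with \<open>0 < e\<close> show "\<exists>N. \<forall>n\<ge>N. norm (l2_dist V (u n) f - 0) < e"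
        by (intro exI[of _ N]) (force simp: l2_dist_def l2_norm_nonneg)
    qed
  qed
qed

text \<open>
  The projection argument: points of \<open>S\<close> whose distances to \<open>k\<close> approach the infimum form a Cauchy
  sequence by the parallelogram law, since the midpoint of two of them is again in \<open>S\<close>. For their
  limit \<open>p\<close> the residual \<open>k - p\<close> is orthogonal to \<open>S\<close>, because moving from \<open>p\<close> in a direction of \<open>S\<close>
  cannot decrease the distance. So \<open>k - p\<close> vanishes and \<open>k\<close> is a limit of points of \<open>S\<close>.
\<close>

lemma l2_dense_if_orthogonal_trivial:
  assumes S: "S \<subseteq> l2 V" "S \<noteq> {}"
    and add: "\<And>f g. f \<in> S \<Longrightarrow> g \<in> S \<Longrightarrow> (\<lambda>x. f x + g x) \<in> S"
    and cmult: "\<And>c f. f \<in> S \<Longrightarrow> (\<lambda>x. c * f x) \<in> S"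
    and orth: "\<And>r. r \<in> l2 V \<Longrightarrow> (\<And>q. q \<in> S \<Longrightarrow> l2_inner V q r = 0) \<Longrightarrow> r = (\<lambda>x. 0)"
  shows "l2_dense V S"
  unfolding l2_dense_def
proof (intro conjI ballI allI impI)
  show "S \<subseteq> l2 V" by fact
next
  fix k and \<epsilon> :: real assume k: "k \<in> l2 V" and "0 < \<epsilon>"
  define d where "d = (INF w\<in>S. (l2_dist V k w)\<^sup>2)"
  have S_l2: "w \<in> l2 V" if "w \<in> S" for w
    using S that by auto
  have bdd: "bdd_below ((\<lambda>w. (l2_dist V k w)\<^sup>2) ` S)"
    by (intro bdd_belowI2[where m=0]) auto
  have d_le: "d \<le> (l2_dist V k w)\<^sup>2" if "w \<in> S" for w
    unfolding d_def using bdd that by (rule cINF_lower)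
  have "\<exists>w\<in>S. (l2_dist V k w)\<^sup>2 < d + 1 / (real n + 1)" for n
    using S(2) bdd by (subst cINF_less_iff[symmetric]) (auto simp: d_def[symmetric])
  then obtain w where w: "\<And>n. w n \<in> S"
    and w_less: "\<And>n. (l2_dist V k (w n))\<^sup>2 < d + 1 / (real n + 1)"
    by metis
  have w_l2: "w n \<in> l2 V" for n
    using w S_l2 by blast
  have parallelogram: "(l2_dist V (w m) (w n))\<^sup>2 \<le> 2 / (real m + 1) + 2 / (real n + 1)" for m n
  proof -
    let ?a = "\<lambda>x. k x - w m x" and ?b = "\<lambda>x. k x - w n x"
    let ?mid = "\<lambda>x. (1/2) * (w m x + w n x)"
    have ab: "?a \<in> l2 V" "?b \<in> l2 V"
      by (auto intro: l2_diff k w_l2)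
    have "l2_norm V (\<lambda>x. ?a x + ?b x) = l2_norm V (\<lambda>x. 2 * (k x - ?mid x))"
      by (rule arg_cong[where f="l2_norm V"]) (auto simp: algebra_simps)
    also have "\<dots> = 2 * l2_dist V k ?mid"
      by (simp only: l2_norm_cmult l2_dist_def) simp
    finally have "(l2_norm V (\<lambda>x. ?a x + ?b x))\<^sup>2 = 4 * (l2_dist V k ?mid)\<^sup>2"
      by (simp add: power_mult_distrib)
    also have "\<dots> \<ge> 4 * d"
      using d_le[OF cmult[OF add[OF w[of m] w[of n]], of "1/2"]] by simp
    finally have "4 * d \<le> (l2_norm V (\<lambda>x. ?a x + ?b x))\<^sup>2" .
    moreover have "l2_dist V (w m) (w n) = l2_norm V (\<lambda>x. ?a x - ?b x)"
      by (subst l2_dist_commute) (simp add: l2_dist_def)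
    ultimately show ?thesis
      using w_less[of m] w_less[of n] l2_norm_add_power2[OF ab] l2_norm_diff_power2[OF ab]
      by (simp add: l2_dist_def)
  qed
  have cauchy: "\<exists>N. \<forall>m\<ge>N. \<forall>n\<ge>N. l2_dist V (w m) (w n) < e" if "0 < e" for e
  proof -
    obtain N :: nat where N: "4 / e\<^sup>2 < real N"
      using reals_Archimedean2 by blast
    have "l2_dist V (w m) (w n) < e" if "N \<le> m" "N \<le> n" for m n
    proof (rule power2_less_imp_less)
      have "4 < e\<^sup>2 * real N"
        using N \<open>0 < e\<close> by (simp add: field_simps)
      also have "\<dots> \<le> e\<^sup>2 * (real N + 1)"
        by (intro mult_left_mono) auto
      finally have "4 / (real N + 1) < e\<^sup>2"
        by (simp add: field_simps)
      moreover have "2 / (real m + 1) \<le> 2 / (real N + 1)" "2 / (real n + 1) \<le> 2 / (real N + 1)"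
        using that by (auto intro!: divide_left_mono)
      moreover have "4 / (real N + 1) = 2 / (real N + 1) + 2 / (real N + 1)"
        by (simp flip: add_divide_distrib)
      ultimately show "(l2_dist V (w m) (w n))\<^sup>2 < e\<^sup>2"
        using parallelogram[of m n] by linarith
    qed (use \<open>0 < e\<close> in simp)
    then show ?thesis by blast
  qed
  obtain p where p: "p \<in> l2 V" "(\<lambda>n. l2_dist V (w n) p) \<longlonglongrightarrow> 0"
    using l2_complete[OF w_l2 cauchy] by blast
  let ?r = "\<lambda>x. k x - p x"
  have r: "?r \<in> l2 V"
    by (intro l2_diff k p)
  \<comment> \<open>The first variation is computed at \<open>w n\<close> and passed to the limit. A one-sided bound on the
     real part is enough, since \<open>S\<close> is closed under multiplication by complex scalars.\<close>
  have Re_le_0: "Re (l2_inner V ?r q) \<le> 0" if q: "q \<in> S" for q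
  proof -
    have q_l2: "q \<in> l2 V"
      using q S_l2 by blast
    have step: "2 * Re (l2_inner V ?r q) \<le> t * (l2_norm V q)\<^sup>2" if t: "0 < t" for t
    proof -
      have "2 * t * Re (l2_inner V k q - l2_inner V (w n) q)
          \<le> 1 / (real n + 1) + t\<^sup>2 * (l2_norm V q)\<^sup>2" for n
      proof -
        let ?tq = "\<lambda>x. complex_of_real t * q x"
        have tq: "?tq \<in> l2 V"
          by (intro l2_cmult q_l2)
        have "d \<le> (l2_dist V k (\<lambda>x. w n x + ?tq x))\<^sup>2"
          by (intro d_le add w cmult q)
        also have "l2_dist V k (\<lambda>x. w n x + ?tq x) = l2_norm V (\<lambda>x. (k x - w n x) - ?tq x)"
          by (simp add: l2_dist_def diff_diff_eq)
        also have "\<dots>\<^sup>2 = (l2_dist V k (w n))\<^sup>2 + t\<^sup>2 * (l2_norm V q)\<^sup>2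
            - 2 * Re (l2_inner V (\<lambda>x. k x - w n x) ?tq)"
          unfolding l2_norm_diff_power2[OF l2_diff[OF k w_l2] tq]
          by (simp add: l2_dist_def l2_norm_cmult power_mult_distrib)
        also have "l2_inner V (\<lambda>x. k x - w n x) ?tq
            = complex_of_real t * (l2_inner V k q - l2_inner V (w n) q)"
          by (subst l2_inner_commute, subst l2_inner_cmult_left)
            (simp add: l2_inner_commute[of V _ q] l2_inner_diff_right k w_l2 q_l2)
        finally show ?thesis
          using w_less[of n] by (simp add: algebra_simps)
      qed
      moreover have "(\<lambda>n. 2 * t * Re (l2_inner V k q - l2_inner V (w n) q))
          \<longlonglongrightarrow> 2 * t * Re (l2_inner V k q - l2_inner V p q)"
        by (intro tendsto_intros tendsto_l2_inner_left w_l2 p q_l2)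
      moreover have "(\<lambda>n. 1 / (real n + 1) + t\<^sup>2 * (l2_norm V q)\<^sup>2) \<longlonglongrightarrow> 0 + t\<^sup>2 * (l2_norm V q)\<^sup>2"
        using LIMSEQ_inverse_real_of_nat
        by (intro tendsto_intros) (simp add: inverse_eq_divide add.commute)
      ultimately have "2 * t * Re (l2_inner V k q - l2_inner V p q) \<le> 0 + t\<^sup>2 * (l2_norm V q)\<^sup>2"
        by (intro LIMSEQ_le) auto
      then have "t * (2 * Re (l2_inner V ?r q)) \<le> t * (t * (l2_norm V q)\<^sup>2)"
        by (simp add: l2_inner_diff_left k p q_l2 power2_eq_square algebra_simps)
      then show ?thesis
        using t by (simp add: mult_le_cancel_left_pos)
    qed
    have "((\<lambda>t. t * (l2_norm V q)\<^sup>2) \<longlongrightarrow> 0 * (l2_norm V q)\<^sup>2) (at_right 0)"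
      by (intro tendsto_intros)
    then have "2 * Re (l2_inner V ?r q) \<le> 0 * (l2_norm V q)\<^sup>2"
      by (rule tendsto_lowerbound) (auto simp: eventually_at_right_less step intro!: eventually_at_rightI[of 0 1])
    then show ?thesis by simp
  qed
  have "?r = (\<lambda>x. 0)"
  proof (rule orth[OF r])
    fix q assume q: "q \<in> S"
    \<comment> \<open>This multiple of \<open>q\<close> turns the inner product into \<open>\<bar>l2_inner V q ?r\<bar>\<^sup>2\<close>.\<close>
    let ?c = "cnj (l2_inner V q ?r)"
    have "l2_inner V ?r (\<lambda>x. ?c * q x) = cnj (?c * l2_inner V q ?r)"
      by (subst l2_inner_commute) (simp only: l2_inner_cmult_left)
    also have "\<dots> = complex_of_real ((cmod (l2_inner V q ?r))\<^sup>2)"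
      by (simp only: complex_norm_square) (simp add: mult.commute)
    finally have "(cmod (l2_inner V q ?r))\<^sup>2 \<le> 0"
      using Re_le_0[OF cmult[OF q, of ?c]] by simp
    then show "l2_inner V q ?r = 0" by simp
  qed
  then have "p = k"
    by (auto simp: fun_eq_iff)
  then have "\<forall>\<^sub>F n in sequentially. l2_dist V (w n) k < \<epsilon>"
    using p(2) \<open>0 < \<epsilon>\<close> by (auto dest: order_tendstoD(2))
  then obtain n where "l2_dist V (w n) k < \<epsilon>"
    using eventually_happens' sequentially_bot by blast
  then show "\<exists>g\<in>S. l2_dist V k g < \<epsilon>"
    using w by (subst l2_dist_commute) blast
qed

section \<open>The Laplacian on finitely supported functions\<close>

lemma l2_inner_finite_sum:
  assumes "finite F" "F \<subseteq> V" "\<And>x. x \<in> V - F \<Longrightarrow> f x * cnj (g x) = 0"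
  shows "l2_inner V f g = (\<Sum>x\<in>F. f x * cnj (g x))"
proof -
  have "l2_inner V f g = (\<Sum>\<^sub>\<infinity>x\<in>F. f x * cnj (g x))"
    unfolding l2_inner_def using assms by (intro infsum_cong_neutral) auto
  then show ?thesis
    using assms(1) by simp
qed

lemma point_mass_in_finsupp_funs: "a \<in> V \<Longrightarrow> (\<lambda>x. if x = a then 1 else 0) \<in> finsupp_funs V"
  by (auto simp: finsupp_funs_def funs_on_def)

lemma l2_inner_point_mass_left:
  assumes "a \<in> V"
  shows "l2_inner V (\<lambda>x. if x = a then 1 else 0) g = cnj (g a)"
  using l2_inner_finite_sum[of "{a}" V "\<lambda>x. if x = a then 1 else 0" g] assms by simp

lemma nbrs_commute: "x \<in> V \<Longrightarrow> y \<in> V \<Longrightarrow> y \<in> nbrs V E x \<longleftrightarrow> x \<in> nbrs V E y"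
  by (simp add: nbrs_def adj_def insert_commute)

lemma nbrs_subset: "nbrs V E x \<subseteq> V"
  by (auto simp: nbrs_def)

lemma finite_nbrs: "locally_finite_graph V E \<Longrightarrow> x \<in> V \<Longrightarrow> finite (nbrs V E x)"
  by (simp add: locally_finite_graph_def)

lemma laplacian_zero: "laplacian V E (\<lambda>x. 0) = (\<lambda>x. 0)"
  by (auto simp: laplacian_def)

lemma laplacian_add:
  "laplacian V E (\<lambda>x. f x + g x) = (\<lambda>x. laplacian V E f x + laplacian V E g x)"
  by (auto simp: laplacian_def sum.distrib algebra_simps)

lemma laplacian_cmult: "laplacian V E (\<lambda>x. c * f x) = (\<lambda>x. c * laplacian V E f x)"
  by (auto simp: laplacian_def sum_distrib_left algebra_simps)

lemma laplacian_diff: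
  "laplacian V E (\<lambda>x. f x - g x) = (\<lambda>x. laplacian V E f x - laplacian V E g x)"
  by (auto simp: laplacian_def sum_subtractf algebra_simps)

text \<open>
  Local finiteness keeps the support of \<open>\<Delta> f\<close> inside the finite set formed by the support of \<open>f\<close> and
  its neighbours, so the pairings below reduce to finite sums over that set.
\<close>

lemma finite_support_neighbourhood:
  assumes "locally_finite_graph V E" "f \<in> finsupp_funs V"
  defines "S \<equiv> {x \<in> V. f x \<noteq> 0}"
  defines "F \<equiv> S \<union> (\<Union>y\<in>S. nbrs V E y)"
  shows "finite F" "F \<subseteq> V" "\<And>x. x \<notin> F \<Longrightarrow> laplacian V E f x = 0"
proof -
  show "finite F"
    using assms(1,2) by (auto simp: F_def S_def finsupp_funs_def finite_nbrs)
  show "F \<subseteq> V"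
    using nbrs_subset by (fastforce simp: F_def S_def)
  show "laplacian V E f x = 0" if "x \<notin> F" for x
  proof (cases "x \<in> V")
    case True
    have "f y = 0" if "y \<in> nbrs V E x" for y
      using \<open>x \<notin> F\<close> True that nbrs_commute[of x V y E] nbrs_subset[of V E x]
      by (auto simp: F_def S_def)
    moreover have "f x = 0"
      using \<open>x \<notin> F\<close> True by (auto simp: F_def S_def)
    ultimately show ?thesis
      by (simp add: laplacian_def)
  qed (simp add: laplacian_def)
qed

lemma laplacian_in_finsupp_funs:
  assumes "locally_finite_graph V E" "f \<in> finsupp_funs V"
  shows "laplacian V E f \<in> finsupp_funs V"
proof -
  have "finite {x \<in> V. laplacian V E f x \<noteq> 0}"
    by (rule finite_subset[OF _ finite_support_neighbourhood(1)[OF assms]])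
      (use finite_support_neighbourhood(3)[OF assms] in blast)
  then show ?thesis
    by (simp add: finsupp_funs_def funs_on_def laplacian_def)
qed

text \<open>
  Since \<open>f\<close> has finite support, both sides are finite sums and adjacency is symmetric, so the order of
  summation over adjacent pairs can be exchanged whatever the growth of \<open>g\<close>. Allowing arbitrary \<open>g\<close>
  is what identifies the adjoint later.
\<close>

lemma laplacian_green:
  assumes lf: "locally_finite_graph V E" and f: "f \<in> finsupp_funs V"
  shows "l2_inner V (laplacian V E f) g = l2_inner V f (laplacian V E g)"
proof -
  define S where "S = {x \<in> V. f x \<noteq> 0}"
  define F where "F = S \<union> (\<Union>y\<in>S. nbrs V E y)"
  let ?m = "\<lambda>x. of_nat (valence V E x) :: complex"
  have S: "finite S" "S \<subseteq> V"
    using f by (auto simp: S_def finsupp_funs_def)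
  have F: "finite F" "F \<subseteq> V" "\<And>x. x \<notin> F \<Longrightarrow> laplacian V E f x = 0"
    using finite_support_neighbourhood[OF lf f] by (auto simp: F_def S_def)
  have "S \<subseteq> F"
    by (auto simp: F_def)
  have "(\<Sum>x\<in>F. \<Sum>y\<in>nbrs V E x. f y * cnj (g x))
      = (\<Sum>x\<in>F. \<Sum>y\<in>{y \<in> S. y \<in> nbrs V E x}. f y * cnj (g x))"
  proof (rule sum.cong[OF refl], rule sum.mono_neutral_right)
    show "finite (nbrs V E x)" if "x \<in> F" for x
      using that F(2) finite_nbrs[OF lf] by auto
    show "\<forall>y\<in>nbrs V E x - {y \<in> S. y \<in> nbrs V E x}. f y * cnj (g x) = 0" for x
      using nbrs_subset[of V E x] by (auto simp: S_def)
  qed auto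
  also have "\<dots> = (\<Sum>y\<in>S. \<Sum>x\<in>{x \<in> F. y \<in> nbrs V E x}. f y * cnj (g x))"
    by (rule sum.swap_restrict) (use S F in auto)
  also have "\<dots> = (\<Sum>y\<in>S. \<Sum>x\<in>nbrs V E y. f y * cnj (g x))"
  proof (intro sum.cong refl)
    fix y assume "y \<in> S"
    then have "nbrs V E y \<subseteq> F"
      by (auto simp: F_def)
    then show "{x \<in> F. y \<in> nbrs V E x} = nbrs V E y"
      using \<open>y \<in> S\<close> S(2) F(2) nbrs_commute[of _ V y E] by blast
  qed
  finally have off: "(\<Sum>x\<in>F. \<Sum>y\<in>nbrs V E x. f y * cnj (g x))
      = (\<Sum>y\<in>S. \<Sum>x\<in>nbrs V E y. f y * cnj (g x))" .
  have diag: "(\<Sum>x\<in>F. ?m x * f x * cnj (g x)) = (\<Sum>x\<in>S. ?m x * f x * cnj (g x))"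
    using F(1,2) \<open>S \<subseteq> F\<close> by (intro sum.mono_neutral_right) (auto simp: S_def)
  have "l2_inner V (laplacian V E f) g = (\<Sum>x\<in>F. laplacian V E f x * cnj (g x))"
    using F by (intro l2_inner_finite_sum) auto
  also have "\<dots> = (\<Sum>x\<in>F. ?m x * f x * cnj (g x) - (\<Sum>y\<in>nbrs V E x. f y * cnj (g x)))"
    using F(2) by (intro sum.cong refl) (auto simp: laplacian_def sum_distrib_right left_diff_distrib)
  also have "\<dots> = (\<Sum>x\<in>S. ?m x * f x * cnj (g x) - (\<Sum>y\<in>nbrs V E x. f x * cnj (g y)))"
    by (simp only: sum_subtractf diag off)
  also have "\<dots> = (\<Sum>x\<in>S. f x * cnj (laplacian V E g x))"
    using S(2) by (intro sum.cong refl) (auto simp: laplacian_def sum_distrib_left algebra_simps)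
  also have "\<dots> = l2_inner V f (laplacian V E g)"
    using S by (intro l2_inner_finite_sum[symmetric]) (auto simp: S_def)
  finally show ?thesis .
qed

text \<open>
  A localized form of the fact that the quadratic form of \<open>\<Delta>\<close> is the Dirichlet energy. For an
  edge from \<open>x\<close> to \<open>y\<close> the real part of \<open>(u x - u y) * cnj (u x)\<close> is at least
  \<open>(\<bar>u x\<bar>\<^sup>2 - \<bar>u y\<bar>\<^sup>2) / 2\<close>. Summed over the edges leaving the support, these differences cancel inside
  the support and are nonnegative on its boundary, where \<open>u y = 0\<close>.
\<close>

lemma laplacian_nonneg:
  assumes lf: "locally_finite_graph V E" and u: "u \<in> finsupp_funs V"
  shows "0 \<le> Re (l2_inner V (laplacian V E u) u)"
proof -
  define S where "S = {x \<in> V. u x \<noteq> 0}"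
  let ?N = "nbrs V E"
  let ?q = "\<lambda>x. (cmod (u x))\<^sup>2"
  have S: "finite S" "S \<subseteq> V"
    using u by (auto simp: S_def finsupp_funs_def)
  have fin: "finite (?N x)" if "x \<in> S" for x
    using that S(2) finite_nbrs[OF lf] by auto
  have "(\<Sum>x\<in>S. \<Sum>y\<in>?N x. ?q y) = (\<Sum>x\<in>S. \<Sum>y\<in>{y \<in> S. y \<in> ?N x}. ?q y)"
    by (rule sum.cong[OF refl], rule sum.mono_neutral_right)
      (use fin nbrs_subset[of V E] in \<open>auto simp: S_def\<close>)
  also have "\<dots> = (\<Sum>y\<in>S. \<Sum>x\<in>{x \<in> S. y \<in> ?N x}. ?q y)"
    by (rule sum.swap_restrict) (use S in auto)
  also have "\<dots> \<le> (\<Sum>y\<in>S. \<Sum>x\<in>?N y. ?q y)"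
  proof (intro sum_mono sum_mono2)
    show "{x \<in> S. y \<in> ?N x} \<subseteq> ?N y" if "y \<in> S" for y
      using that S(2) nbrs_commute[of _ V y E] by blast
  qed (use fin in auto)
  finally have le: "(\<Sum>x\<in>S. \<Sum>y\<in>?N x. ?q y) \<le> (\<Sum>x\<in>S. \<Sum>y\<in>?N x. ?q x)" .
  have pointwise: "(?q x - ?q y) / 2 \<le> Re ((u x - u y) * cnj (u x))" for x y
  proof -
    have "Re ((u x - u y) * cnj (u x)) - (?q x - ?q y) / 2 = (cmod (u x - u y))\<^sup>2 / 2"
      by (simp add: cmod_power2) (simp add: power2_eq_square field_simps)
    moreover have "0 \<le> (cmod (u x - u y))\<^sup>2 / 2"
      by simp
    ultimately show ?thesis by linarith
  qed
  have "0 \<le> (\<Sum>x\<in>S. \<Sum>y\<in>?N x. (?q x - ?q y) / 2)"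
    using le by (simp add: sum_divide_distrib[symmetric] sum_subtractf del: sum_constant)
  also have "\<dots> \<le> (\<Sum>x\<in>S. \<Sum>y\<in>?N x. Re ((u x - u y) * cnj (u x)))"
    by (intro sum_mono pointwise)
  also have "\<dots> = Re (\<Sum>x\<in>S. laplacian V E u x * cnj (u x))"
    unfolding Re_sum
  proof (rule sum.cong[OF refl])
    fix x assume "x \<in> S"
    then have "x \<in> V"
      using S(2) by auto
    then show "(\<Sum>y\<in>?N x. Re ((u x - u y) * cnj (u x))) = Re (laplacian V E u x * cnj (u x))"
      by (simp only: laplacian_eq_sum_diff sum_distrib_right Re_sum)
  qed
  also have "(\<Sum>x\<in>S. laplacian V E u x * cnj (u x)) = l2_inner V (laplacian V E u) u"
    using S by (intro l2_inner_finite_sum[symmetric]) (auto simp: S_def)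
  finally show ?thesis .
qed

text \<open>
  Nonnegativity makes the cross term in \<open>\<parallel>\<Delta> u + u\<parallel>\<^sup>2\<close> nonnegative. The estimate says that \<open>\<Delta> + 1\<close> has
  a bounded inverse on its range, which transfers convergence of \<open>\<Delta> u + u\<close> to \<open>u\<close>.
\<close>

lemma l2_norm_le_laplacian_plus_id:
  assumes "locally_finite_graph V E" "u \<in> finsupp_funs V"
  shows "l2_norm V u \<le> l2_norm V (\<lambda>x. laplacian V E u x + u x)"
proof (rule power2_le_imp_le)
  have "u \<in> l2 V" "laplacian V E u \<in> l2 V"
    using assms laplacian_in_finsupp_funs finsupp_funs_subset_l2 by blast+
  then have "(l2_norm V (\<lambda>x. laplacian V E u x + u x))\<^sup>2
      = (l2_norm V (laplacian V E u))\<^sup>2 + (l2_norm V u)\<^sup>2 + 2 * Re (l2_inner V (laplacian V E u) u)"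
    by (intro l2_norm_add_power2)
  then show "(l2_norm V u)\<^sup>2 \<le> (l2_norm V (\<lambda>x. laplacian V E u x + u x))\<^sup>2"
    using laplacian_nonneg[OF assms] by simp
qed (simp add: l2_norm_nonneg)

lemma finite_superlevel_l2:
  assumes "g \<in> l2 V" "0 < c"
  shows "finite {x \<in> V. c \<le> cmod (g x)}"
proof -
  obtain C :: nat where C: "(l2_norm V g)\<^sup>2 / c\<^sup>2 \<le> real C"
    using real_arch_simple by blast
  have "card F \<le> C" if F: "F \<subseteq> {x \<in> V. c \<le> cmod (g x)}" "finite F" for F
  proof -
    have "real (card F) * c\<^sup>2 = (\<Sum>x\<in>F. c\<^sup>2)"
      by simp
    also have "\<dots> \<le> (\<Sum>x\<in>F. (cmod (g x))\<^sup>2)"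
      using F assms(2) by (intro sum_mono power_mono) auto
    also have "\<dots> \<le> (l2_norm V g)\<^sup>2"
      unfolding l2_norm_power2 using F by (intro finite_sum_le_infsum l2_summable assms) auto
    finally have "real (card F) \<le> (l2_norm V g)\<^sup>2 / c\<^sup>2"
      using assms(2) by (simp add: field_simps)
    then show ?thesis
      using C by linarith
  qed
  then show ?thesis
    using finite_if_finite_subsets_card_bdd by blast
qed

text \<open>
  The maximum principle. Square-summability yields a vertex \<open>b\<close> where \<open>\<bar>g\<bar>\<close> is maximal, and the equation
  at \<open>b\<close> forces the sum of \<open>m b\<close> values of modulus at most \<open>\<bar>g b\<bar>\<close> to have modulus
  \<open>(m b + 1) * \<bar>g b\<bar>\<close>.
\<close>

lemma laplacian_eigenvalue_minus_one:
  assumes lf: "locally_finite_graph V E" and g: "g \<in> l2 V"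
    and eq: "\<And>x. x \<in> V \<Longrightarrow> laplacian V E g x = - g x"
  shows "g = (\<lambda>x. 0)"
proof (rule ccontr)
  assume "g \<noteq> (\<lambda>x. 0)"
  then obtain a where a: "g a \<noteq> 0" by auto
  then have "a \<in> V"
    using l2_funs_on[OF g] by auto
  define P where "P = {x \<in> V. cmod (g a) \<le> cmod (g x)}"
  have "finite P" "a \<in> P"
    using finite_superlevel_l2[OF g] a \<open>a \<in> V\<close> by (auto simp: P_def)
  then obtain b where b: "b \<in> P" and b_max: "\<And>x. x \<in> P \<Longrightarrow> cmod (g x) \<le> cmod (g b)"
    using obtains_MAX[of P "\<lambda>x. cmod (g x)"]
    by (metis Max_ge empty_iff finite_imageI imageI)
  have "b \<in> V" and gb: "cmod (g a) \<le> cmod (g b)"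
    using b by (auto simp: P_def)
  have max: "cmod (g y) \<le> cmod (g b)" if "y \<in> V" for y
    using b_max[of y] that gb by (cases "y \<in> P") (auto simp: P_def)
  let ?m = "valence V E b"
  have "(of_nat ?m + 1) * g b = (\<Sum>y\<in>nbrs V E b. g y)"
    using eq[OF \<open>b \<in> V\<close>] \<open>b \<in> V\<close> by (simp add: laplacian_def algebra_simps)
  then have "(real ?m + 1) * cmod (g b) = cmod (\<Sum>y\<in>nbrs V E b. g y)"
    by (metis norm_mult norm_of_nat of_nat_Suc add.commute)
  also have "\<dots> \<le> (\<Sum>y\<in>nbrs V E b. cmod (g b))"
    using max nbrs_subset[of V E b] by (intro sum_norm_le) auto
  also have "\<dots> = real ?m * cmod (g b)"
    by (simp add: valence_def)
  finally have "cmod (g b) \<le> 0"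
    by (simp add: algebra_simps)
  with gb a show False by simp
qed

section \<open>The maximal Laplacian\<close>

definition laplacian_max :: "'v set \<Rightarrow> 'v set set \<Rightarrow> 'v op_graph" where
  "laplacian_max V E = {(f, laplacian V E f) | f. f \<in> l2 V \<and> laplacian V E f \<in> l2 V}"

lemma laplacian_min_subset_max:
  assumes "locally_finite_graph V E"
  shows "laplacian_min V E \<subseteq> laplacian_max V E"
  using assms laplacian_in_finsupp_funs finsupp_funs_subset_l2
  by (fastforce simp: laplacian_min_def laplacian_max_def)

text \<open>
  Testing the defining relation of the adjoint against point masses determines \<open>h\<close> as \<open>\<Delta> g\<close> at each
  vertex; Green's formula gives the converse.
\<close>

lemma op_adjoint_laplacian_min:
  assumes "locally_finite_graph V E"
  shows "op_adjoint V (laplacian_min V E) = laplacian_max V E"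
proof (intro equalityI subrelI)
  fix g h assume gh: "(g, h) \<in> op_adjoint V (laplacian_min V E)"
  have "h x = laplacian V E g x" for x
  proof (cases "x \<in> V")
    case True
    let ?d = "\<lambda>y. if y = x then 1 else 0 :: complex"
    have "l2_inner V (laplacian V E ?d) g = l2_inner V ?d h"
      using gh point_mass_in_finsupp_funs[OF True] by (auto simp: op_adjoint_def laplacian_min_def)
    then have "cnj (laplacian V E g x) = cnj (h x)"
      using laplacian_green[OF assms point_mass_in_finsupp_funs[OF True], of g] True
      by (simp add: l2_inner_point_mass_left)
    then show ?thesis by simp
  next
    case False
    then show ?thesis
      using gh by (auto simp: op_adjoint_def l2_funs_on laplacian_def)
  qed
  then have "h = laplacian V E g" by auto
  then show "(g, h) \<in> laplacian_max V E"
    using gh by (auto simp: op_adjoint_def laplacian_max_def)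
next
  fix g h assume "(g, h) \<in> laplacian_max V E"
  then show "(g, h) \<in> op_adjoint V (laplacian_min V E)"
    using laplacian_green[OF assms]
    by (auto simp: op_adjoint_def laplacian_max_def laplacian_min_def)
qed

text \<open>
  Norm convergence implies pointwise convergence, and the value of \<open>\<Delta> f\<close> at a vertex depends on only
  finitely many values of \<open>f\<close>.
\<close>

lemma op_closure_laplacian_min_subset_max:
  assumes "locally_finite_graph V E"
  shows "op_closure V (laplacian_min V E) \<subseteq> laplacian_max V E"
proof (rule subrelI)
  fix f g assume "(f, g) \<in> op_closure V (laplacian_min V E)"
  then obtain u v where fg: "f \<in> l2 V" "g \<in> l2 V" and uv: "\<And>n. (u n, v n) \<in> laplacian_min V E"
    and lim: "(\<lambda>n. l2_dist V (u n) f) \<longlonglongrightarrow> 0" "(\<lambda>n. l2_dist V (v n) g) \<longlonglongrightarrow> 0"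
    by (auto simp: op_closure_def)
  have v: "v n = laplacian V E (u n)" and l2: "u n \<in> l2 V" "v n \<in> l2 V" for n
    using uv[of n] laplacian_min_subset_max[OF assms] by (auto simp: laplacian_max_def)
  have "g x = laplacian V E f x" for x
  proof (rule LIMSEQ_unique)
    show "(\<lambda>n. v n x) \<longlonglongrightarrow> g x"
      by (rule l2_tendsto_pointwise[OF l2(2) fg(2) lim(2)])
    show "(\<lambda>n. v n x) \<longlonglongrightarrow> laplacian V E f x"
      unfolding v laplacian_def
      using l2_tendsto_pointwise[OF l2(1) fg(1) lim(1)] by (auto intro!: tendsto_intros)
  qed
  then have "g = laplacian V E f" by auto
  with fg show "(f, g) \<in> laplacian_max V E"
    by (auto simp: laplacian_max_def)
qed

text \<open>
  A function orthogonal to the range is orthogonal to the images of the point masses, so it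
  satisfies \<open>\<Delta> r = - r\<close> by Green's formula and vanishes by the maximum principle.
\<close>

lemma l2_dense_range_laplacian_plus_id:
  assumes lf: "locally_finite_graph V E"
  shows "l2_dense V ((\<lambda>u x. laplacian V E u x + u x) ` finsupp_funs V)"
proof (rule l2_dense_if_orthogonal_trivial)
  let ?T = "\<lambda>u x. laplacian V E u x + u x"
  have fs_l2: "u \<in> l2 V" "laplacian V E u \<in> l2 V" if "u \<in> finsupp_funs V" for u
    using that lf laplacian_in_finsupp_funs finsupp_funs_subset_l2 by blast+
  show "?T ` finsupp_funs V \<subseteq> l2 V"
    using l2_add[OF fs_l2(2,1)] by blast
  show "?T ` finsupp_funs V \<noteq> {}"
    using zero_in_finsupp_funs by blast
  show "(\<lambda>x. f x + g x) \<in> ?T ` finsupp_funs V"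
    if fg: "f \<in> ?T ` finsupp_funs V" "g \<in> ?T ` finsupp_funs V" for f g
  proof -
    obtain u v where uv: "f = ?T u" "u \<in> finsupp_funs V" "g = ?T v" "v \<in> finsupp_funs V"
      using fg by blast
    then have "(\<lambda>x. f x + g x) = ?T (\<lambda>x. u x + v x)"
      by (simp add: laplacian_add algebra_simps)
    then show ?thesis
      using finsupp_funs_add[OF uv(2,4)] by blast
  qed
  show "(\<lambda>x. c * f x) \<in> ?T ` finsupp_funs V" if f: "f \<in> ?T ` finsupp_funs V" for c f
  proof -
    obtain u where u: "f = ?T u" "u \<in> finsupp_funs V"
      using f by blast
    then have "(\<lambda>x. c * f x) = ?T (\<lambda>x. c * u x)"
      by (simp add: laplacian_cmult algebra_simps)
    then show ?thesis
      using finsupp_funs_cmult[OF u(2)] by blast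
  qed
  show "r = (\<lambda>x. 0)" if r: "r \<in> l2 V"
    and orth: "\<And>q. q \<in> ?T ` finsupp_funs V \<Longrightarrow> l2_inner V q r = 0" for r
  proof (rule laplacian_eigenvalue_minus_one[OF lf r])
    fix a assume a: "a \<in> V"
    let ?d = "\<lambda>y. if y = a then 1 else 0 :: complex"
    have d: "?d \<in> finsupp_funs V"
      by (rule point_mass_in_finsupp_funs[OF a])
    have "0 = l2_inner V (?T ?d) r"
      using orth[OF imageI[OF d]] by simp
    also have "\<dots> = l2_inner V (laplacian V E ?d) r + l2_inner V ?d r"
      by (intro l2_inner_add_left fs_l2 d r)
    also have "\<dots> = cnj (laplacian V E r a + r a)"
      using a by (simp add: laplacian_green[OF lf d] l2_inner_point_mass_left)
    finally show "laplacian V E r a = - r a"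
      by (simp add: eq_neg_iff_add_eq_0 del: complex_cnj_add)
  qed
qed

text \<open>
  The equation \<open>\<Delta> f + f = \<Delta> g + g\<close> is solved inside the closure by approximating its right-hand side from
  the dense range; the solution coincides with \<open>g\<close> by the maximum principle.
\<close>

lemma laplacian_max_subset_op_closure:
  assumes lf: "locally_finite_graph V E"
  shows "laplacian_max V E \<subseteq> op_closure V (laplacian_min V E)"
proof (rule subrelI)
  let ?L = "laplacian V E"
  let ?T = "\<lambda>u x. ?L u x + u x"
  fix g h assume "(g, h) \<in> laplacian_max V E"
  then have g: "g \<in> l2 V" "?L g \<in> l2 V" and h: "h = ?L g"
    by (auto simp: laplacian_max_def)
  define k where "k = ?T g"
  have k: "k \<in> l2 V"
    unfolding k_def by (intro l2_add g)
  have "\<exists>u\<in>finsupp_funs V. l2_dist V k (?T u) < inverse (real (Suc n))" for n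
    using l2_dense_range_laplacian_plus_id[OF lf] k by (auto simp: l2_dense_def)
  then obtain u where u: "\<And>n. u n \<in> finsupp_funs V"
    and dist_u: "\<And>n. l2_dist V k (?T (u n)) < inverse (real (Suc n))"
    by metis
  have u_l2: "u n \<in> l2 V" "?L (u n) \<in> l2 V" for n
    using u lf laplacian_in_finsupp_funs finsupp_funs_subset_l2 by blast+
  have w_lim: "(\<lambda>n. l2_dist V (?T (u n)) k) \<longlonglongrightarrow> 0"
  proof (rule tendsto_sandwich[OF _ _ tendsto_const LIMSEQ_inverse_real_of_nat])
    show "\<forall>\<^sub>F n in sequentially. l2_dist V (?T (u n)) k \<le> inverse (real (Suc n))"
      using dist_u by (intro always_eventually allI) (simp add: l2_dist_commute less_imp_le)
  qed (simp add: l2_dist_def l2_norm_nonneg)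
  have coercive: "l2_dist V (u m) (u n) \<le> l2_dist V (?T (u m)) k + l2_dist V (?T (u n)) k" for m n
  proof -
    have "(\<lambda>x. u m x - u n x) \<in> finsupp_funs V"
      using finsupp_funs_add[OF u[of m] finsupp_funs_cmult[OF u[of n], of "-1"]] by simp
    from l2_norm_le_laplacian_plus_id[OF lf this]
    have "l2_dist V (u m) (u n) \<le> l2_dist V (?T (u m)) (?T (u n))"
      by (simp add: l2_dist_def laplacian_diff algebra_simps)
    also have "\<dots> \<le> l2_dist V (?T (u m)) k + l2_dist V k (?T (u n))"
      by (intro l2_dist_triangle l2_add u_l2 k)
    finally show ?thesis
      by (simp add: l2_dist_commute[of V k])
  qed
  have cauchy: "\<exists>N. \<forall>m\<ge>N. \<forall>n\<ge>N. l2_dist V (u m) (u n) < e" if "0 < e" for e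
  proof -
    obtain N where "\<And>n. N \<le> n \<Longrightarrow> l2_dist V (?T (u n)) k < e / 2"
      using order_tendstoD(2)[OF w_lim half_gt_zero[OF \<open>0 < e\<close>]]
      by (auto simp: eventually_sequentially)
    then show ?thesis
      using coercive by (intro exI[of _ N]) (smt (verit) field_sum_of_halves)
  qed
  obtain f where f: "f \<in> l2 V" and f_lim: "(\<lambda>n. l2_dist V (u n) f) \<longlonglongrightarrow> 0"
    using l2_complete[OF u_l2(1) cauchy] by blast
  let ?h = "\<lambda>x. k x - f x"
  have h_lim: "(\<lambda>n. l2_dist V (?L (u n)) ?h) \<longlonglongrightarrow> 0"
  proof (rule tendsto_sandwich[OF _ _ tendsto_const])
    have "l2_dist V (?L (u n)) ?h \<le> l2_dist V (?T (u n)) k + l2_dist V (u n) f" for n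
    proof -
      have "l2_dist V (?L (u n)) ?h = l2_norm V (\<lambda>x. (?T (u n) x - k x) + (f x - u n x))"
        by (simp add: l2_dist_def algebra_simps)
      also have "\<dots> \<le> l2_dist V (?T (u n)) k + l2_dist V f (u n)"
        unfolding l2_dist_def by (intro l2_norm_triangle l2_diff l2_add u_l2 k f)
      finally show ?thesis
        by (simp add: l2_dist_commute[of V f])
    qed
    then show "\<forall>\<^sub>F n in sequentially.
        l2_dist V (?L (u n)) ?h \<le> l2_dist V (?T (u n)) k + l2_dist V (u n) f"
      by simp
    show "(\<lambda>n. l2_dist V (?T (u n)) k + l2_dist V (u n) f) \<longlonglongrightarrow> 0"
      using tendsto_add[OF w_lim f_lim] by simp
  qed (simp add: l2_dist_def l2_norm_nonneg)
  have cl: "(f, ?h) \<in> op_closure V (laplacian_min V E)"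
  proof -
    have "(u n, ?L (u n)) \<in> laplacian_min V E" for n
      using u by (auto simp: laplacian_min_def)
    then have "\<exists>u v. (\<forall>n. (u n, v n) \<in> laplacian_min V E) \<and>
        (\<lambda>n. l2_dist V (u n) f) \<longlonglongrightarrow> 0 \<and> (\<lambda>n. l2_dist V (v n) ?h) \<longlonglongrightarrow> 0"
      using f_lim h_lim by (intro exI[of _ u] exI[of _ "\<lambda>n. ?L (u n)"]) simp
    with f l2_diff[OF k f] show ?thesis
      by (simp add: op_closure_def)
  qed
  then have "?h = ?L f"
    using op_closure_laplacian_min_subset_max[OF lf] by (auto simp: laplacian_max_def)
  have "(\<lambda>x. g x - f x) = (\<lambda>x. 0)"
  proof (rule laplacian_eigenvalue_minus_one[OF lf l2_diff[OF g(1) f]])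
    fix x
    have "k x - f x = ?L f x"
      using \<open>?h = ?L f\<close> by metis
    then show "?L (\<lambda>x. g x - f x) x = - (g x - f x)"
      by (simp add: laplacian_diff k_def algebra_simps)
  qed
  then have "g = f"
    by (auto simp: fun_eq_iff)
  with cl \<open>?h = ?L f\<close> h show "(g, h) \<in> op_closure V (laplacian_min V E)"
    by simp
qed

lemma op_closure_laplacian_min:
  "locally_finite_graph V E \<Longrightarrow> op_closure V (laplacian_min V E) = laplacian_max V E"
  by (intro equalityI op_closure_laplacian_min_subset_max laplacian_max_subset_op_closure)

text \<open>
  Taking adjoints reverses inclusions, which leaves the symmetry of the maximal operator. One
  factor is approximated in graph norm by finitely supported functions, for which the other factor
  is known to lie in the adjoint, and the inner products converge.
\<close>

lemma op_adjoint_laplacian_max: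
  assumes lf: "locally_finite_graph V E"
  shows "op_adjoint V (laplacian_max V E) = laplacian_max V E"
proof
  have "op_adjoint V (laplacian_max V E) \<subseteq> op_adjoint V (laplacian_min V E)"
    using laplacian_min_subset_max[OF lf] by (fastforce simp: op_adjoint_def)
  then show "op_adjoint V (laplacian_max V E) \<subseteq> laplacian_max V E"
    by (simp add: op_adjoint_laplacian_min[OF lf])
next
  show "laplacian_max V E \<subseteq> op_adjoint V (laplacian_max V E)"
  proof (rule subrelI)
    fix g h assume gh: "(g, h) \<in> laplacian_max V E"
    then have gh_adj: "(g, h) \<in> op_adjoint V (laplacian_min V E)"
      by (simp add: op_adjoint_laplacian_min[OF lf])
    have "l2_inner V f' g = l2_inner V f h" if ff': "(f, f') \<in> laplacian_max V E" for f f'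
    proof -
      have "(f, f') \<in> op_closure V (laplacian_min V E)"
        using ff' by (simp add: op_closure_laplacian_min[OF lf])
      then obtain u v where f: "f \<in> l2 V" "f' \<in> l2 V" and uv: "\<And>n. (u n, v n) \<in> laplacian_min V E"
        and lim: "(\<lambda>n. l2_dist V (u n) f) \<longlonglongrightarrow> 0" "(\<lambda>n. l2_dist V (v n) f') \<longlonglongrightarrow> 0"
        by (auto simp: op_closure_def)
      have l2: "u n \<in> l2 V" "v n \<in> l2 V" for n
        using uv[of n] laplacian_min_subset_max[OF lf] by (auto simp: laplacian_max_def)
      have gh_l2: "g \<in> l2 V" "h \<in> l2 V"
        using gh by (auto simp: laplacian_max_def)
      have "l2_inner V (v n) g = l2_inner V (u n) h" for n
        using gh_adj uv[of n] by (auto simp: op_adjoint_def)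
      then show ?thesis
        using tendsto_l2_inner_left[OF l2(1) f(1) gh_l2(2) lim(1)]
          tendsto_l2_inner_left[OF l2(2) f(2) gh_l2(1) lim(2)]
        by (auto intro: LIMSEQ_unique)
    qed
    then show "(g, h) \<in> op_adjoint V (laplacian_max V E)"
      using gh by (auto simp: op_adjoint_def laplacian_max_def)
  qed
qed

section \<open>Essential self-adjointness\<close>

lemma l2_dense_finsupp_funs: "l2_dense V (finsupp_funs V)"
proof (rule l2_dense_if_orthogonal_trivial)
  show "finsupp_funs V \<noteq> {}"
    using zero_in_finsupp_funs by blast
  show "r = (\<lambda>x. 0)" if r: "r \<in> l2 V"
    and orth: "\<And>q. q \<in> finsupp_funs V \<Longrightarrow> l2_inner V q r = 0" for r
  proof
    fix a show "r a = 0"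
    proof (cases "a \<in> V")
      case True
      then show ?thesis
        using orth[OF point_mass_in_finsupp_funs[OF True]] by (simp add: l2_inner_point_mass_left)
    qed (rule l2_funs_on[OF r])
  qed
qed (auto intro: finsupp_funs_add finsupp_funs_cmult finsupp_funs_subset_l2[THEN subsetD])

lemma densely_defined_laplacian_min:
  assumes "locally_finite_graph V E"
  shows "densely_defined_op V (laplacian_min V E)"
proof -
  have "Domain (laplacian_min V E) = finsupp_funs V"
    by (auto simp: laplacian_min_def)
  moreover have "laplacian_min V E \<subseteq> l2 V \<times> l2 V"
    using laplacian_min_subset_max[OF assms] by (auto simp: laplacian_max_def)
  moreover have "((\<lambda>x. 0), (\<lambda>x. 0)) \<in> laplacian_min V E"
    unfolding laplacian_min_def
    by (intro CollectI exI[of _ "\<lambda>x. 0"]) (simp add: laplacian_zero zero_in_finsupp_funs)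
  ultimately show ?thesis
    by (auto simp: densely_defined_op_def linear_op_def l2_dense_finsupp_funs single_valued_def
        laplacian_min_def laplacian_add laplacian_cmult finsupp_funs_add finsupp_funs_cmult)
qed

lemma densely_defined_laplacian_max:
  assumes "locally_finite_graph V E"
  shows "densely_defined_op V (laplacian_max V E)"
proof -
  have "finsupp_funs V \<subseteq> Domain (laplacian_max V E)"
    using laplacian_min_subset_max[OF assms] by (auto simp: laplacian_min_def)
  moreover have "Domain (laplacian_max V E) \<subseteq> l2 V"
    by (auto simp: laplacian_max_def)
  ultimately have "l2_dense V (Domain (laplacian_max V E))"
    using l2_dense_finsupp_funs[of V] by (fastforce simp: l2_dense_def)
  moreover have "((\<lambda>x. 0), (\<lambda>x. 0)) \<in> laplacian_max V E"
    unfolding laplacian_max_def by (intro CollectI exI[of _ "\<lambda>x. 0"]) (simp add: laplacian_zero l2_zero)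
  ultimately show ?thesis
    by (auto simp: densely_defined_op_def linear_op_def single_valued_def
        laplacian_max_def laplacian_add laplacian_cmult l2_add l2_cmult)
qed

theorem theorem2p1:
  fixes V :: "'v set" and E :: "'v set set"
  assumes "ugraph V E"
    and "countable V"
    and "locally_finite_graph V E"
    and "connected_graph V E"
  shows "essentially_self_adjoint V (laplacian_min V E)"
proof -
  note lf = assms(3)
  have "laplacian_min V E \<subseteq> op_adjoint V (laplacian_min V E)"
    using laplacian_min_subset_max[OF lf] op_adjoint_laplacian_min[OF lf] by simp
  then have "symmetric_op V (laplacian_min V E)"
    using densely_defined_laplacian_min[OF lf] by (fastforce simp: symmetric_op_def op_adjoint_def)
  moreover have "self_adjoint_op V (laplacian_max V E)"
    using densely_defined_laplacian_max[OF lf] op_adjoint_laplacian_max[OF lf]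
    by (simp add: self_adjoint_op_def)
  ultimately show ?thesis
    by (simp add: essentially_self_adjoint_def op_closure_laplacian_min[OF lf])
qed

end
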